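(* Let $f:X\to X$ be a continuous map on a compact metric space $(X,d)$, let $Z\subset X$ be a Borel subset and let $\mu$ be a Borel probability measure on $X$. Then for any $s\ge0$ and any continuous $\phi:X\to\mathbb{R}$: 1) If $\overline P_\mu(f,\phi,x)\le s$ for all $x\in Z$, then $P_Z(f,\phi)\le s$. 2) If $\mu(Z)>0$ and $\underline P_\mu(f,\phi,x)\ge s$ for all $x\in Z$, then $P_Z(f,\phi)\ge s$.
   Context: The measure $\mu$ is not assumed $f$-invariant. Bowen balls: $B_n(x,r)=\{y\in X: d(f^j(x),f^j(y))<r \text{ for all } 0\le j<n\}$. Local measure-theoretic pressures: for $x\in X$, $$\overline P_\mu(f,\phi,x)=\lim_{\varepsilon\to0}\limsup_{n\to\infty}\frac1n\Big(\sum_{m=0}^{n-1}\phi(f^m(x))-\log\mu(B_n(x,\varepsilon))\Big),$$ $$\underline P_\mu(f,\phi,x)=\lim_{\varepsilon\to0}\liminf_{n\to\infty}\frac1n\Big(\sum_{m=0}^{n-1}\phi(f^m(x))-\log\mu(B_n(x,\varepsilon))\Big)$$ (with $-\log 0=+\infty$). Topological pressure restricted to $Z\subset X$: for $N\in\mathbb N$, $r>0$, $s\ge0$ put $$M_Z(s,r,\phi,N)=\inf\Big\{\sum_{j\in J}\exp\Big[-s\,n_j+\sum_{m=0}^{n_j-1}\phi(f^m(x_j))\Big]:\ Z\subset\bigcup_{j\in J}B_{n_j}(x_j,r),\ n_j\ge N\Big\},$$ where the infimum is over all finite or countable covers of $Z$ by Bowen balls $\{B_{n_j}(x_j,r)\}_{j\in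 J}$ with $n_j\ge N$. This is non-decreasing in $N$; let $M_Z(s,r,\phi)=\lim_{N\to\infty}M_Z(s,r,\phi,N)$. Let $$M_Z(r,\phi)=\sup\{s\ge0: M_Z(s,r,\phi)=\infty\}=\inf\{s\ge0: M_Z(s,r,\phi)=0\}$$ (with $\sup\emptyset=0$), the critical parameter at which $s\mapsto M_Z(s,r,\phi)$ drops from $\infty$ to $0$. It is non-increasing in $r$, and $P_Z(f,\phi)=\lim_{r\to0}M_Z(r,\phi)$. *)

theory Defs
  imports "HOL-Probability.Probability"
begin

text \<open>
  The compact metric space is a compact set \<open>X\<close> in an arbitrary metric type, and the map
  \<open>f\<close> sends \<open>X\<close> to \<open>X\<close>; the potential is \<open>\<phi>\<close>.  Values of \<open>f\<close> and \<open>\<phi>\<close> outside \<open>X\<close> play no role.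
\<close>

definition bowen_ball ::
  "'a::metric_space set \<Rightarrow> ('a \<Rightarrow> 'a) \<Rightarrow> nat \<Rightarrow> 'a \<Rightarrow> real \<Rightarrow> 'a set" where
  "bowen_ball X f n x r = {y \<in> X. \<forall>j<n. dist ((f ^^ j) x) ((f ^^ j) y) < r}"

definition orbit_sum :: "('a \<Rightarrow> 'a) \<Rightarrow> ('a \<Rightarrow> real) \<Rightarrow> nat \<Rightarrow> 'a \<Rightarrow> real" where
  "orbit_sum f \<phi> n x = (\<Sum>m<n. \<phi> ((f ^^ m) x))"

text \<open>\<open>- log p\<close> with the convention \<open>- log 0 = \<infinity>\<close> (the library has \<open>ln 0 = 0\<close>).\<close>

definition neg_log :: "real \<Rightarrow> ereal" where
  "neg_log p = (if p = 0 then \<infinity> else ereal (- ln p))"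

definition local_pressure_term ::
  "'a::metric_space set \<Rightarrow> ('a \<Rightarrow> 'a) \<Rightarrow> ('a \<Rightarrow> real) \<Rightarrow> 'a measure \<Rightarrow> 'a \<Rightarrow> real \<Rightarrow> nat \<Rightarrow> ereal" where
  "local_pressure_term X f \<phi> \<mu> x \<epsilon> n =
     (ereal (orbit_sum f \<phi> n x) + neg_log (measure \<mu> (bowen_ball X f n x \<epsilon>))) / ereal (real n)"

definition upper_local_pressure ::
  "'a::metric_space set \<Rightarrow> ('a \<Rightarrow> 'a) \<Rightarrow> ('a \<Rightarrow> real) \<Rightarrow> 'a measure \<Rightarrow> 'a \<Rightarrow> ereal" where
  "upper_local_pressure X f \<phi> \<mu> x =
     Lim (at_right 0) (\<lambda>\<epsilon>. limsup (local_pressure_term X f \<phi> \<mu> x \<epsilon>))"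

definition lower_local_pressure ::
  "'a::metric_space set \<Rightarrow> ('a \<Rightarrow> 'a) \<Rightarrow> ('a \<Rightarrow> real) \<Rightarrow> 'a measure \<Rightarrow> 'a \<Rightarrow> ereal" where
  "lower_local_pressure X f \<phi> \<mu> x =
     Lim (at_right 0) (\<lambda>\<epsilon>. liminf (local_pressure_term X f \<phi> \<mu> x \<epsilon>))"

text \<open>
  Finite and countable families of Bowen balls are indexed by arbitrary subsets \<open>J\<close> of
  the naturals.  Centres range over all of \<open>X\<close>, not only over \<open>Z\<close>.
\<close>

definition pressure_cover_inf ::
  "'a::metric_space set \<Rightarrow> ('a \<Rightarrow> 'a) \<Rightarrow> ('a \<Rightarrow> real) \<Rightarrow> 'a set \<Rightarrow> real \<Rightarrow> real \<Rightarrow> nat \<Rightarrow> ennreal" where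
  "pressure_cover_inf X f \<phi> Z s r N =
     Inf {\<Sum>\<^sub>\<infinity>j\<in>J. ennreal (exp (- s * real (n j) + orbit_sum f \<phi> (n j) (x j))) |
          (J :: nat set) (n :: nat \<Rightarrow> nat) (x :: nat \<Rightarrow> 'a).
          (\<forall>j\<in>J. x j \<in> X \<and> N \<le> n j) \<and> Z \<subseteq> (\<Union>j\<in>J. bowen_ball X f (n j) (x j) r)}"

definition pressure_outer ::
  "'a::metric_space set \<Rightarrow> ('a \<Rightarrow> 'a) \<Rightarrow> ('a \<Rightarrow> real) \<Rightarrow> 'a set \<Rightarrow> real \<Rightarrow> real \<Rightarrow> ennreal" where
  "pressure_outer X f \<phi> Z s r = lim (\<lambda>N. pressure_cover_inf X f \<phi> Z s r N)"

text \<open>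
  The element \<open>0\<close> implements \<open>sup \<emptyset> = 0\<close> (in \<open>ereal\<close>, \<open>Sup {} = -\<infinity>\<close>); it has no effect
  otherwise, since only parameters \<open>s \<ge> 0\<close> are considered.
\<close>

definition critical_pressure ::
  "'a::metric_space set \<Rightarrow> ('a \<Rightarrow> 'a) \<Rightarrow> ('a \<Rightarrow> real) \<Rightarrow> 'a set \<Rightarrow> real \<Rightarrow> ereal" where
  "critical_pressure X f \<phi> Z r =
     Sup (insert 0 {ereal s | s. 0 \<le> s \<and> pressure_outer X f \<phi> Z s r = \<infinity>})"

definition topological_pressure ::
  "'a::metric_space set \<Rightarrow> ('a \<Rightarrow> 'a) \<Rightarrow> ('a \<Rightarrow> real) \<Rightarrow> 'a set \<Rightarrow> ereal" where
  "topological_pressure X f \<phi> Z = Lim (at_right 0) (critical_pressure X f \<phi> Z)"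


text \<open>
  All limits above are monotone.  The following facts show that they exist, so that
  \<open>Lim\<close> and \<open>lim\<close> denote genuine limits.
\<close>

lemma tendsto_at_right_0_SUP:
  fixes g :: "real \<Rightarrow> 'b::{complete_linorder, linorder_topology}"
  assumes "\<And>a b. 0 < a \<Longrightarrow> a \<le> b \<Longrightarrow> g b \<le> g a"
  shows "(g \<longlongrightarrow> (SUP e\<in>{0<..}. g e)) (at_right 0)"
proof (rule order_tendstoI)
  fix a assume "a < (SUP e\<in>{0<..}. g e)"
  then obtain e where e: "0 < e" "a < g e" by (auto simp: less_SUP_iff)
  have "\<forall>\<^sub>F d in at_right 0. d \<in> {0<..<e}"
    using e(1) by (rule eventually_at_right_real)
  then show "\<forall>\<^sub>F d in at_right 0. a < g d"
  proof eventually_elim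
    case (elim d)
    then have "g e \<le> g d" by (intro assms) auto
    with e(2) show ?case by (rule less_le_trans)
  qed
next
  fix a assume a: "(SUP e\<in>{0<..}. g e) < a"
  have "\<forall>\<^sub>F d in at_right 0. d \<in> {0<..<1::real}"
    by (rule eventually_at_right_real) simp
  then show "\<forall>\<^sub>F d in at_right 0. g d < a"
  proof eventually_elim
    case (elim d)
    then have "g d \<le> (SUP e\<in>{0<..}. g e)" by (intro SUP_upper) auto
    with a show ?case by simp
  qed
qed

lemma bowen_ball_mono: "a \<le> b \<Longrightarrow> bowen_ball X f n x a \<subseteq> bowen_ball X f n x b"
  by (auto simp: bowen_ball_def dest: less_le_trans)

lemma bowen_ball_measurable:
  fixes X :: "'a::metric_space set"
  assumes "continuous_on X f" "f \<in> X \<rightarrow> X" "x \<in> X"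
  shows "bowen_ball X f n x r \<in> sets (restrict_space borel X)"
proof -
  have iter: "continuous_on X (f ^^ j) \<and> (f ^^ j) \<in> X \<rightarrow> X" for j
  proof (induction j)
    case 0
    show ?case by simp
  next
    case (Suc j)
    then have "(f ^^ j) ` X \<subseteq> X" by (simp add: image_subset_iff_funcset)
    with assms(1) have "continuous_on ((f ^^ j) ` X) f" by (rule continuous_on_subset)
    with conjunct1[OF Suc] have "continuous_on X (f \<circ> (f ^^ j))"
      by (rule continuous_on_compose)
    moreover have "f \<circ> (f ^^ j) \<in> X \<rightarrow> X"
      using Suc assms(2) by (simp add: Pi_iff)
    ultimately show ?case by (simp add: comp_def)
  qed
  have *: "X \<inter> (f ^^ j) -` ball ((f ^^ j) x) r \<in> sets (restrict_space borel X)" for j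
  proof -
    obtain T where "open T" and "T \<inter> X = (f ^^ j) -` ball ((f ^^ j) x) r \<inter> X"
      using conjunct1[OF iter[of j], unfolded continuous_on_open_invariant,
          rule_format, OF open_ball[of "(f ^^ j) x" r]] by blast
    then have "X \<inter> (f ^^ j) -` ball ((f ^^ j) x) r = X \<inter> T"
      by (simp add: Int_commute)
    then show ?thesis
      unfolding sets_restrict_space using borel_open[OF \<open>open T\<close>] by (rule image_eqI)
  qed
  define A where "A j = X \<inter> (f ^^ j) -` ball ((f ^^ j) x) r" for j
  have "bowen_ball X f n x r = X \<inter> (\<Inter>j\<in>{..<n}. A j)"
    by (auto simp: bowen_ball_def A_def)
  also have "\<dots> \<in> sets (restrict_space borel X)"
  proof (cases "n = 0")
    case True
    then show ?thesis
      using sets.top[of "restrict_space borel X"] by (simp add: space_restrict_space)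
  next
    case False
    then have "{..<n} \<noteq> {}" by (simp add: lessThan_empty_iff)
    moreover have "A j \<in> sets (restrict_space borel X)" for j
      unfolding A_def by (rule *)
    ultimately have "(\<Inter>j\<in>{..<n}. A j) \<in> sets (restrict_space borel X)"
      by (intro sets.finite_INT) simp_all
    moreover have "X \<inter> (\<Inter>j\<in>{..<n}. A j) = (\<Inter>j\<in>{..<n}. A j)"
      using False by (intro Int_absorb1 INF_lower2[of 0]) (auto simp: A_def)
    ultimately show ?thesis by metis
  qed
  finally show ?thesis .
qed

lemma local_pressure_term_antimono:
  assumes "continuous_on X f" "f \<in> X \<rightarrow> X" "x \<in> X"
    and "prob_space \<mu>" "sets \<mu> = sets (restrict_space borel X)" and "a \<le> b"
  shows "local_pressure_term X f \<phi> \<mu> x b n \<le> local_pressure_term X f \<phi> \<mu> x a n"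
proof -
  interpret prob_space \<mu> by fact
  have "bowen_ball X f n x b \<in> sets \<mu>"
    unfolding assms(5) by (rule bowen_ball_measurable[OF assms(1-3)])
  then have "measure \<mu> (bowen_ball X f n x a) \<le> measure \<mu> (bowen_ball X f n x b)"
    by (rule finite_measure_mono[OF bowen_ball_mono[OF assms(6)]])
  then have "neg_log (measure \<mu> (bowen_ball X f n x b)) \<le> neg_log (measure \<mu> (bowen_ball X f n x a))"
    using measure_nonneg[of \<mu> "bowen_ball X f n x a"] measure_nonneg[of \<mu> "bowen_ball X f n x b"]
    unfolding neg_log_def by (smt (verit) ereal_less_eq(1,3) ln_le_cancel_iff)
  then have "ereal (orbit_sum f \<phi> n x) + neg_log (measure \<mu> (bowen_ball X f n x b))
      \<le> ereal (orbit_sum f \<phi> n x) + neg_log (measure \<mu> (bowen_ball X f n x a))"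
    by (rule add_left_mono)
  moreover have "0 \<le> inverse (ereal (real n))"
    by (rule inverse_ereal_ge0I) simp
  ultimately show ?thesis
    unfolding local_pressure_term_def divide_ereal_def by (rule ereal_mult_right_mono)
qed

lemma
  assumes "continuous_on X f" "f \<in> X \<rightarrow> X" "x \<in> X"
    and "prob_space \<mu>" "sets \<mu> = sets (restrict_space borel X)"
  shows upper_local_pressure_tendsto:
      "((\<lambda>\<epsilon>. limsup (local_pressure_term X f \<phi> \<mu> x \<epsilon>)) \<longlongrightarrow> upper_local_pressure X f \<phi> \<mu> x) (at_right 0)"
    and lower_local_pressure_tendsto:
      "((\<lambda>\<epsilon>. liminf (local_pressure_term X f \<phi> \<mu> x \<epsilon>)) \<longlongrightarrow> lower_local_pressure X f \<phi> \<mu> x) (at_right 0)"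
proof -
  note mono = local_pressure_term_antimono[OF assms]
  let ?U = "\<lambda>\<epsilon>. limsup (local_pressure_term X f \<phi> \<mu> x \<epsilon>)"
  let ?L = "\<lambda>\<epsilon>. liminf (local_pressure_term X f \<phi> \<mu> x \<epsilon>)"
  have "(?U \<longlongrightarrow> (SUP e\<in>{0<..}. ?U e)) (at_right 0)"
    by (intro tendsto_at_right_0_SUP Limsup_mono always_eventually allI mono)
  then show "(?U \<longlongrightarrow> upper_local_pressure X f \<phi> \<mu> x) (at_right 0)"
    by (simp add: upper_local_pressure_def tendsto_Lim)
  have "(?L \<longlongrightarrow> (SUP e\<in>{0<..}. ?L e)) (at_right 0)"
    by (intro tendsto_at_right_0_SUP Liminf_mono always_eventually allI mono)
  then show "(?L \<longlongrightarrow> lower_local_pressure X f \<phi> \<mu> x) (at_right 0)"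
    by (simp add: lower_local_pressure_def tendsto_Lim)
qed

lemma pressure_cover_inf_mono:
  assumes "M \<le> N" "b \<le> a"
  shows "pressure_cover_inf X f \<phi> Z s a M \<le> pressure_cover_inf X f \<phi> Z s b N"
  unfolding pressure_cover_inf_def
proof (rule Inf_superset_mono, clarify)
  fix J :: "nat set" and n x
  assume *: "\<forall>j\<in>J. x j \<in> X \<and> N \<le> n j" "Z \<subseteq> (\<Union>j\<in>J. bowen_ball X f (n j) (x j) b)"
  have "(\<Union>j\<in>J. bowen_ball X f (n j) (x j) b) \<subseteq> (\<Union>j\<in>J. bowen_ball X f (n j) (x j) a)"
    by (rule UN_mono) (simp_all add: bowen_ball_mono assms)
  with *(2) have "Z \<subseteq> (\<Union>j\<in>J. bowen_ball X f (n j) (x j) a)"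
    by (rule subset_trans)
  moreover have "\<forall>j\<in>J. x j \<in> X \<and> M \<le> n j"
    using *(1) assms(1) le_trans by blast
  ultimately have "(\<forall>j\<in>J. x j \<in> X \<and> M \<le> n j) \<and> Z \<subseteq> (\<Union>j\<in>J. bowen_ball X f (n j) (x j) a)"
    by simp
  then show "\<exists>(J'::nat set) n' x'.
      (\<Sum>\<^sub>\<infinity>j\<in>J. ennreal (exp (- s * real (n j) + orbit_sum f \<phi> (n j) (x j)))) =
      (\<Sum>\<^sub>\<infinity>j\<in>J'. ennreal (exp (- s * real (n' j) + orbit_sum f \<phi> (n' j) (x' j)))) \<and>
      (\<forall>j\<in>J'. x' j \<in> X \<and> M \<le> n' j) \<and> Z \<subseteq> (\<Union>j\<in>J'. bowen_ball X f (n' j) (x' j) a)"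
    by (intro exI[of _ J] exI[of _ n] exI[of _ x]) simp
qed

lemma pressure_outer_tendsto:
  "(\<lambda>N. pressure_cover_inf X f \<phi> Z s r N) \<longlonglongrightarrow> pressure_outer X f \<phi> Z s r"
proof -
  have "incseq (pressure_cover_inf X f \<phi> Z s r)"
    by (rule monoI) (rule pressure_cover_inf_mono, simp_all)
  from LIMSEQ_SUP[OF this] show ?thesis
    unfolding pressure_outer_def by (simp add: limI)
qed

lemma critical_pressure_antimono:
  assumes "a \<le> b"
  shows "critical_pressure X f \<phi> Z b \<le> critical_pressure X f \<phi> Z a"
proof -
  have le: "pressure_outer X f \<phi> Z s b \<le> pressure_outer X f \<phi> Z s a" for s
    by (rule LIMSEQ_le[OF pressure_outer_tendsto pressure_outer_tendsto])
      (simp add: pressure_cover_inf_mono assms)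
  have top: "pressure_outer X f \<phi> Z s a = \<infinity>" if "pressure_outer X f \<phi> Z s b = \<infinity>" for s
    using le[of s] that by (simp add: top_unique)
  have "insert 0 {ereal s | s. 0 \<le> s \<and> pressure_outer X f \<phi> Z s b = \<infinity>}
      \<subseteq> insert 0 {ereal s | s. 0 \<le> s \<and> pressure_outer X f \<phi> Z s a = \<infinity>}"
    using top by blast
  then show ?thesis
    unfolding critical_pressure_def by (rule Sup_subset_mono)
qed

lemma topological_pressure_tendsto:
  "(critical_pressure X f \<phi> Z \<longlongrightarrow> topological_pressure X f \<phi> Z) (at_right 0)"
  unfolding topological_pressure_def
  using tendsto_at_right_0_SUP[of "critical_pressure X f \<phi> Z", OF critical_pressure_antimono]
  by (simp add: tendsto_Lim)

end

theory Submission
  imports Defs "HOL-Real_Asymp.Real_Asymp"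
begin

text \<open>
  Upper bound: let \<open>s < u < t\<close> and let \<open>Y n\<close> be the set of \<open>x \<in> Z\<close> with
  \<open>exp (S\<^sub>n \<phi> x - u n) \<le> \<mu> (B\<^sub>n (x, r/2))\<close>.  Every point of \<open>Z\<close> lies in \<open>Y n\<close> for all large \<open>n\<close>.
  A maximal family of disjoint balls \<open>B\<^sub>n (x, r/2)\<close> centred in \<open>Y n\<close> has total mass at most 1, and
  the balls of radius \<open>r\<close> cover \<open>Y n\<close>, contributing at most \<open>exp (- (t - u) n)\<close>.  The union over
  \<open>n \<ge> N\<close> covers \<open>Z\<close> at a cost bounded by a geometric series, so no Vitali-type selection
  among balls of different lengths is needed.

  Lower bound: if \<open>P\<^sub>Z < t < t' < s\<close>, then \<open>Z\<close> is a countable union of sets on which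
  \<open>\<mu> (B\<^sub>n (x, \<epsilon>)) \<le> exp (S\<^sub>n \<phi> x - t' n)\<close> for all \<open>n \<ge> m\<close>.  Moving the centres of a cover into such a
  set changes \<open>S\<^sub>n \<phi>\<close> by at most \<open>\<delta> n\<close>, by uniform continuity of \<open>\<phi>\<close>.  As the cost of covers at
  parameter \<open>t\<close> stays bounded for \<open>N \<rightarrow> \<infinity>\<close>, each of these sets is null, hence so is \<open>Z\<close>.
\<close>

section \<open>Infinite sums, one-sided limits and logarithms\<close>

lemma infsum_ennreal_le:
  fixes g :: "'b \<Rightarrow> ennreal"
  assumes "\<And>F. finite F \<Longrightarrow> F \<subseteq> A \<Longrightarrow> sum g F \<le> c"
  shows "infsum g A \<le> c"
  using assms by (subst nonneg_infsum_complete) (auto intro: SUP_least)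

lemma sum_le_infsum_ennreal:
  fixes g :: "'b \<Rightarrow> ennreal"
  assumes "finite F" "F \<subseteq> A"
  shows "sum g F \<le> infsum g A"
  using assms by (subst nonneg_infsum_complete) (auto intro: SUP_upper)

text \<open>Making the sets outside \<open>J\<close> empty reduces the claim to subadditivity along
  a full sequence. The sum over \<open>J\<close> has the shape of a cover cost in
  \<open>pressure_cover_inf\<close>.\<close>

lemma emeasure_UN_le_infsum:
  fixes B :: "nat \<Rightarrow> 'a set"
  assumes "\<And>j. j \<in> J \<Longrightarrow> B j \<in> sets M"
  shows "emeasure M (\<Union>j\<in>J. B j) \<le> (\<Sum>\<^sub>\<infinity>j\<in>J. emeasure M (B j))"
proof -
  define A where "A j = (if j \<in> J then B j else {})" for j
  have "(\<Union>j\<in>J. B j) = (\<Union>j. A j)"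
    by (auto simp: A_def split: if_splits)
  moreover have "emeasure M (\<Union>j. A j) \<le> (\<Sum>j. emeasure M (A j))"
    using assms by (intro emeasure_subadditive_countably) (auto simp: A_def)
  moreover have "(\<Sum>j. emeasure M (A j)) \<le> (\<Sum>\<^sub>\<infinity>j\<in>J. emeasure M (B j))"
    unfolding suminf_eq_SUP
  proof (rule SUP_least)
    fix n
    have "(\<Sum>j<n. emeasure M (A j)) = (\<Sum>j\<in>{..<n} \<inter> J. emeasure M (B j))"
      by (auto simp: A_def sum.inter_restrict intro!: sum.cong)
    also have "\<dots> \<le> (\<Sum>\<^sub>\<infinity>j\<in>J. emeasure M (B j))"
      by (rule sum_le_infsum_ennreal) auto
    finally show "(\<Sum>j<n. emeasure M (A j)) \<le> (\<Sum>\<^sub>\<infinity>j\<in>J. emeasure M (B j))" .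
  qed
  ultimately show ?thesis by simp
qed

text \<open>On \<open>(0, e)\<close> the values of \<open>g\<close> dominate \<open>g e\<close>, so
  the limit does too. This turns bounds on limiting pressures into bounds at each fixed
  radius.\<close>

lemma antimono_le_limit_at_right_0:
  fixes g :: "real \<Rightarrow> 'b::{complete_linorder, linorder_topology}"
  assumes "\<And>a b. a \<le> b \<Longrightarrow> g b \<le> g a" "(g \<longlongrightarrow> L) (at_right 0)" "0 < e"
  shows "g e \<le> L"
proof -
  have "\<forall>\<^sub>F d in at_right 0. d \<in> {0<..<e}"
    using assms(3) by (rule eventually_at_right_real)
  then have "\<forall>\<^sub>F d in at_right 0. g e \<le> g d"
    by eventually_elim (use assms(1) in auto)
  with assms(2) show ?thesis
    by (rule tendsto_lowerbound) simp
qed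

text \<open>This trades a local pressure bound for a mass bound without logarithms. At
  \<open>p = 0\<close> both sides are false, since \<open>neg_log\<close> is then infinite.\<close>

lemma neg_log_quotient_less_iff:
  assumes "0 < n" "0 \<le> p"
  shows "(ereal c + neg_log p) / ereal (real n) < ereal u \<longleftrightarrow> exp (c - u * real n) < p"
proof (cases "p = 0")
  case True
  then show ?thesis using assms by (simp add: neg_log_def)
next
  case False
  then have "0 < p" using assms by simp
  have "(ereal c + neg_log p) / ereal (real n) < ereal u \<longleftrightarrow> (c - ln p) / real n < u"
    using False assms by (simp add: neg_log_def)
  also have "\<dots> \<longleftrightarrow> c - u * real n < ln p"
    using assms by (auto simp: pos_divide_less_eq)
  also have "\<dots> \<longleftrightarrow> exp (c - u * real n) < p"
    using \<open>0 < p\<close> by (metis exp_less_cancel_iff exp_ln)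
  finally show ?thesis .
qed

lemma neg_log_quotient_ge_iff:
  assumes "0 < n" "0 \<le> p"
  shows "ereal u \<le> (ereal c + neg_log p) / ereal (real n) \<longleftrightarrow> p \<le> exp (c - u * real n)"
  using neg_log_quotient_less_iff[OF assms] by (metis not_less)

section \<open>Geometry of Bowen balls\<close>

lemma bowen_ball_center: "x \<in> X \<Longrightarrow> 0 < r \<Longrightarrow> x \<in> bowen_ball X f n x r"
  by (simp add: bowen_ball_def)

lemma bowen_ball_sym:
  "x \<in> X \<Longrightarrow> y \<in> bowen_ball X f n x r \<Longrightarrow> x \<in> bowen_ball X f n y r"
  by (simp add: bowen_ball_def dist_commute)

lemma bowen_ball_trans:
  assumes "y \<in> bowen_ball X f n x a" "z \<in> bowen_ball X f n y b"
  shows "z \<in> bowen_ball X f n x (a + b)"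
  unfolding bowen_ball_def
proof (intro CollectI conjI allI impI)
  show "z \<in> X" using assms(2) by (simp add: bowen_ball_def)
  fix j assume "j < n"
  then have "dist ((f ^^ j) x) ((f ^^ j) y) < a" "dist ((f ^^ j) y) ((f ^^ j) z) < b"
    using assms by (auto simp: bowen_ball_def)
  then show "dist ((f ^^ j) x) ((f ^^ j) z) < a + b"
    using dist_triangle[of "(f ^^ j) x" "(f ^^ j) z" "(f ^^ j) y"] by linarith
qed

lemma funpow_closed: "f \<in> X \<rightarrow> X \<Longrightarrow> x \<in> X \<Longrightarrow> (f ^^ j) x \<in> X"
  by (induction j) auto

text \<open>The first \<open>n\<close> iterates of \<open>x\<close> and \<open>y\<close> stay
  \<open>r\<close>-close, so each of the \<open>n\<close> summands grows by at most
  \<open>\<delta>\<close>.\<close>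

lemma orbit_sum_bowen_ball_le:
  assumes "f \<in> X \<rightarrow> X" "x \<in> X" "y \<in> bowen_ball X f n x r"
    and "\<And>x y. x \<in> X \<Longrightarrow> y \<in> X \<Longrightarrow> dist x y < r \<Longrightarrow> \<phi> y \<le> \<phi> x + \<delta>"
  shows "orbit_sum f \<phi> n y \<le> orbit_sum f \<phi> n x + \<delta> * real n"
proof -
  have "y \<in> X" using assms(3) by (simp add: bowen_ball_def)
  have "orbit_sum f \<phi> n y \<le> (\<Sum>m<n. \<phi> ((f ^^ m) x) + \<delta>)"
    unfolding orbit_sum_def using assms(3)
    by (intro sum_mono assms(4) funpow_closed[OF assms(1)] \<open>x \<in> X\<close> \<open>y \<in> X\<close>)
      (simp add: bowen_ball_def)
  then show ?thesis by (simp add: orbit_sum_def sum.distrib mult.commute)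
qed

section \<open>Upper bound: covers of small cost\<close>

text \<open>Each half-radius ball has mass at least \<open>c\<close>, so a disjoint family has at
  most \<open>1 / c\<close> members and one of greatest cardinality exists. An uncovered point of
  \<open>Y\<close> could be added to it.\<close>

lemma ex_disjoint_bowen_balls_cover:
  assumes "continuous_on X f" "f \<in> X \<rightarrow> X"
    and "prob_space \<mu>" "sets \<mu> = sets (restrict_space borel X)"
    and "0 < r" "Y \<subseteq> X" "0 < c"
    and c: "\<And>x. x \<in> Y \<Longrightarrow> c \<le> measure \<mu> (bowen_ball X f n x (r / 2))"
  obtains E where "finite E" "E \<subseteq> Y" "disjoint_family_on (\<lambda>x. bowen_ball X f n x (r / 2)) E"
    "Y \<subseteq> (\<Union>x\<in>E. bowen_ball X f n x r)"
proof -
  interpret prob_space \<mu> by fact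
  define B where "B x = bowen_ball X f n x (r / 2)" for x
  define P where "P E \<longleftrightarrow> finite E \<and> E \<subseteq> Y \<and> disjoint_family_on B E" for E
  have B: "B x \<in> sets \<mu>" if "x \<in> X" for x
    unfolding B_def assms(4) using assms(1,2) that by (rule bowen_ball_measurable)
  have bound: "card E < nat \<lceil>1 / c\<rceil> + 1" if "P E" for E
  proof -
    have "real (card E) * c \<le> (\<Sum>x\<in>E. measure \<mu> (B x))"
      using sum_mono[of E "\<lambda>_. c" "\<lambda>x. measure \<mu> (B x)"] that c by (auto simp: P_def B_def)
    also have "\<dots> = measure \<mu> (\<Union>x\<in>E. B x)"
      using that B assms(6)
      by (intro finite_measure_finite_Union[symmetric]) (auto simp: P_def)
    also have "\<dots> \<le> 1" by simp
    finally have "real (card E) \<le> 1 / c" using \<open>0 < c\<close> by (simp add: field_simps)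
    then show ?thesis by linarith
  qed
  have "P {}" by (simp add: P_def disjoint_family_on_def)
  then obtain E where E: "P E" and max: "\<And>E'. P E' \<Longrightarrow> card E' \<le> card E"
    using ex_has_greatest_nat[of P "{}" card] bound by blast
  have "Y \<subseteq> (\<Union>x\<in>E. bowen_ball X f n x r)"
  proof (rule ccontr)
    assume "\<not> ?thesis"
    then obtain y where y: "y \<in> Y" "\<And>x. x \<in> E \<Longrightarrow> y \<notin> bowen_ball X f n x r" by auto
    have "y \<notin> E"
      using y bowen_ball_center[OF _ \<open>0 < r\<close>] \<open>Y \<subseteq> X\<close> by blast
    \<comment> \<open>A common point would, by the triangle inequality, put \<open>y\<close> into
      the ball of radius \<open>r\<close> around \<open>x\<close>.\<close>
    have disj: "B x \<inter> B y = {}" if "x \<in> E" for x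
    proof (rule ccontr)
      assume "B x \<inter> B y \<noteq> {}"
      then obtain z where "z \<in> B x" "z \<in> B y" by auto
      then have "y \<in> bowen_ball X f n x (r / 2 + r / 2)"
        using y(1) \<open>Y \<subseteq> X\<close> unfolding B_def
        by (blast intro: bowen_ball_trans bowen_ball_sym)
      with y(2)[OF that] show False by simp
    qed
    have "disjoint_family_on B (insert y E)"
      using E disj \<open>y \<notin> E\<close> by (auto simp: P_def disjoint_family_on_insert)
    then have "P (insert y E)" using E y(1) by (simp add: P_def)
    from max[OF this] show False using E \<open>y \<notin> E\<close> by (simp add: P_def)
  qed
  with E show ?thesis unfolding P_def B_def by (auto intro: that)
qed

text \<open>Disjointness bounds the total weight by the total mass of the half-radius balls, hence
  by 1. Compactness makes \<open>\<phi>\<close> bounded, which supplies the common mass bound for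
  the maximal family.\<close>

lemma ex_bowen_cover_sum_le_1:
  assumes "compact X" "continuous_on X f" "f \<in> X \<rightarrow> X" "continuous_on X \<phi>"
    and "prob_space \<mu>" "sets \<mu> = sets (restrict_space borel X)"
    and "0 < r" "Y \<subseteq> X"
    and Y: "\<And>x. x \<in> Y \<Longrightarrow> exp (orbit_sum f \<phi> n x - u * real n) \<le> measure \<mu> (bowen_ball X f n x (r / 2))"
  obtains E where "finite E" "E \<subseteq> Y" "Y \<subseteq> (\<Union>x\<in>E. bowen_ball X f n x r)"
    "(\<Sum>x\<in>E. exp (orbit_sum f \<phi> n x - u * real n)) \<le> 1"
proof -
  interpret prob_space \<mu> by fact
  have "bounded (\<phi> ` X)"
    using assms(1,4) by (intro compact_imp_bounded compact_continuous_image)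
  then obtain K where K: "\<And>x. x \<in> X \<Longrightarrow> \<bar>\<phi> x\<bar> \<le> K"
    by (auto simp: bounded_iff)
  \<comment> \<open>Since \<open>\<phi> \<ge> - K\<close> on \<open>X\<close>, this is a positive
    lower bound for all weights over \<open>Y\<close>. It may decay with \<open>n\<close>, as it
    only secures finiteness of the family.\<close>
  define c where "c = exp (- K * real n - u * real n)"
  have c: "c \<le> measure \<mu> (bowen_ball X f n x (r / 2))" if "x \<in> Y" for x
  proof -
    have "- K \<le> \<phi> ((f ^^ m) x)" for m
      using K[OF funpow_closed[OF assms(3), of x m]] that \<open>Y \<subseteq> X\<close> by auto
    then have "- K * real n \<le> orbit_sum f \<phi> n x"
      using sum_mono[of "{..<n}" "\<lambda>_. - K" "\<lambda>m. \<phi> ((f ^^ m) x)"]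
      by (simp add: orbit_sum_def mult.commute)
    then have "c \<le> exp (orbit_sum f \<phi> n x - u * real n)" by (simp add: c_def)
    with Y[OF that] show ?thesis by linarith
  qed
  obtain E where E: "finite E" "E \<subseteq> Y" "disjoint_family_on (\<lambda>x. bowen_ball X f n x (r / 2)) E"
    "Y \<subseteq> (\<Union>x\<in>E. bowen_ball X f n x r)"
    using ex_disjoint_bowen_balls_cover[OF assms(2,3,5-8) _ c] by (auto simp: c_def)
  have "(\<Sum>x\<in>E. exp (orbit_sum f \<phi> n x - u * real n))
      \<le> (\<Sum>x\<in>E. measure \<mu> (bowen_ball X f n x (r / 2)))"
    using E(2) by (intro sum_mono Y) auto
  also have "\<dots> = measure \<mu> (\<Union>x\<in>E. bowen_ball X f n x (r / 2))"
    using E \<open>Y \<subseteq> X\<close> bowen_ball_measurable[OF assms(2,3)]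
    by (intro finite_measure_finite_Union[symmetric]) (auto simp: assms(6))
  also have "\<dots> \<le> 1" by simp
  finally show ?thesis using E by (auto intro: that)
qed

text \<open>The covers built below are naturally indexed by pairs of length and centre;
  \<open>to_nat_on\<close> recodes these as natural numbers, for finite and infinite
  \<open>C\<close> alike.\<close>

lemma pressure_cover_inf_le_infsum:
  assumes "countable C" "C \<subseteq> {N..} \<times> X" "Z \<subseteq> (\<Union>(n, x)\<in>C. bowen_ball X f n x r)"
  shows "pressure_cover_inf X f \<phi> Z s r N
    \<le> (\<Sum>\<^sub>\<infinity>(n, x)\<in>C. ennreal (exp (- s * real n + orbit_sum f \<phi> n x)))"
proof -
  define J where "J = to_nat_on C ` C"
  define n where "n j = fst (from_nat_into C j)" for j
  define x where "x j = snd (from_nat_into C j)" for j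
  have J: "n (to_nat_on C p) = fst p" "x (to_nat_on C p) = snd p" if "p \<in> C" for p
    using assms(1) that by (simp_all add: n_def x_def)
  have "(\<Sum>\<^sub>\<infinity>j\<in>J. ennreal (exp (- s * real (n j) + orbit_sum f \<phi> (n j) (x j))))
      = (\<Sum>\<^sub>\<infinity>(n, x)\<in>C. ennreal (exp (- s * real n + orbit_sum f \<phi> n x)))"
    unfolding J_def
    by (subst infsum_reindex[OF inj_on_to_nat_on[OF assms(1)]])
      (auto intro!: infsum_cong simp: J)
  moreover have "\<forall>j\<in>J. x j \<in> X \<and> N \<le> n j"
    using assms(2) by (auto simp: J_def J)
  moreover have "Z \<subseteq> (\<Union>j\<in>J. bowen_ball X f (n j) (x j) r)"
    using assms(3) by (simp add: J_def J split_def)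
  ultimately show ?thesis
    unfolding pressure_cover_inf_def
    by (intro Inf_lower CollectI exI[of _ J] exI[of _ n] exI[of _ x]) auto
qed

text \<open>Finiteness is what keeps \<open>t\<close> out of the supremum that defines
  \<open>critical_pressure\<close>.\<close>

lemma pressure_outer_less_top:
  assumes "compact X" "continuous_on X f" "f \<in> X \<rightarrow> X" "continuous_on X \<phi>"
    and "prob_space \<mu>" "sets \<mu> = sets (restrict_space borel X)"
    and "0 < r" "Z \<subseteq> X" "u < t"
    and Z: "\<And>x. x \<in> Z \<Longrightarrow> limsup (local_pressure_term X f \<phi> \<mu> x (r / 2)) < ereal u"
  shows "pressure_outer X f \<phi> Z t r < \<infinity>"
proof -
  \<comment> \<open>Passing from parameter \<open>u\<close> to \<open>t\<close> multiplies a weight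
    of length \<open>n\<close> by \<open>q ^ n\<close>.\<close>
  define q where "q = exp (u - t)"
  have q: "0 < q" "q < 1" using \<open>u < t\<close> by (auto simp: q_def)
  define Y where "Y n = {x \<in> Z. exp (orbit_sum f \<phi> n x - u * real n)
      \<le> measure \<mu> (bowen_ball X f n x (r / 2))}" for n
  have "\<exists>E. finite E \<and> E \<subseteq> Y n \<and> Y n \<subseteq> (\<Union>x\<in>E. bowen_ball X f n x r)
      \<and> (\<Sum>x\<in>E. exp (orbit_sum f \<phi> n x - u * real n)) \<le> 1" for n
    by (rule ex_bowen_cover_sum_le_1[OF assms(1-7), where Y = "Y n" and n = n and u = u])
      (use \<open>Z \<subseteq> X\<close> in \<open>auto simp: Y_def\<close>)
  then obtain E where E: "\<And>n. finite (E n)" "\<And>n. E n \<subseteq> Y n"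
    "\<And>n. Y n \<subseteq> (\<Union>x\<in>E n. bowen_ball X f n x r)"
    "\<And>n. (\<Sum>x\<in>E n. exp (orbit_sum f \<phi> n x - u * real n)) \<le> 1"
    by metis
  have level: "(\<Sum>x\<in>E n. exp (- t * real n + orbit_sum f \<phi> n x)) \<le> q ^ n" for n
  proof -
    have "(\<Sum>x\<in>E n. exp (- t * real n + orbit_sum f \<phi> n x))
        = q ^ n * (\<Sum>x\<in>E n. exp (orbit_sum f \<phi> n x - u * real n))"
      unfolding sum_distrib_left q_def exp_of_nat_mult[symmetric] exp_add[symmetric]
      by (intro sum.cong refl arg_cong[of _ _ exp]) (simp add: algebra_simps)
    also have "\<dots> \<le> q ^ n"
      using mult_left_mono[OF E(4)[of n], of "q ^ n"] q by simp
    finally show ?thesis .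
  qed
  have "pressure_cover_inf X f \<phi> Z t r N \<le> ennreal (1 / (1 - q))" for N
  proof -
    define C where "C = Sigma {N..} E"
    have "countable C" unfolding C_def using E(1) by (intro countable_SIGMA) (auto intro: countable_finite)
    moreover have "C \<subseteq> {N..} \<times> X"
      using E(2) \<open>Z \<subseteq> X\<close> by (fastforce simp: C_def Y_def)
    moreover have "Z \<subseteq> (\<Union>(n, x)\<in>C. bowen_ball X f n x r)"
    proof
      fix z assume "z \<in> Z"
      have "\<forall>\<^sub>F n in sequentially. local_pressure_term X f \<phi> \<mu> z (r / 2) n < ereal u"
        using Z[OF \<open>z \<in> Z\<close>] by (rule Limsup_lessD)
      \<comment> \<open>Only lengths \<open>n > 0\<close> are considered, since the logarithmic
        equivalence divides by \<open>n\<close>.\<close>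
      then have "\<forall>\<^sub>F n in sequentially. z \<in> Y n"
        using eventually_gt_at_top[of 0]
        by eventually_elim
          (use \<open>z \<in> Z\<close> in \<open>auto simp: Y_def local_pressure_term_def neg_log_quotient_less_iff\<close>)
      then obtain n where "N \<le> n" "z \<in> Y n"
        unfolding eventually_sequentially by (meson nle_le)
      then show "z \<in> (\<Union>(n, x)\<in>C. bowen_ball X f n x r)"
        using E(3)[of n] by (fastforce simp: C_def)
    qed
    ultimately have "pressure_cover_inf X f \<phi> Z t r N
        \<le> (\<Sum>\<^sub>\<infinity>(n, x)\<in>C. ennreal (exp (- t * real n + orbit_sum f \<phi> n x)))"
      by (rule pressure_cover_inf_le_infsum)
    also have "\<dots> \<le> ennreal (1 / (1 - q))"
    proof (rule infsum_ennreal_le)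
      fix F assume F: "finite F" "F \<subseteq> C"
      \<comment> \<open>\<open>M\<close> exceeds all lengths in \<open>F\<close>, so the sum over
        \<open>F\<close> is part of a finite double sum; for empty \<open>F\<close> any value of
        \<open>Max\<close> will do.\<close>
      define M where "M = Suc (Max (fst ` F))"
      have "fst p < M" if "p \<in> F" for p
        using F(1) that by (simp add: M_def less_Suc_eq_le)
      then have "F \<subseteq> Sigma {..<M} E"
        using F(2) by (fastforce simp: C_def)
      then have "(\<Sum>(n, x)\<in>F. exp (- t * real n + orbit_sum f \<phi> n x))
          \<le> (\<Sum>(n, x)\<in>Sigma {..<M} E. exp (- t * real n + orbit_sum f \<phi> n x))"
        using E(1) by (intro sum_mono2) auto
      also have "\<dots> = (\<Sum>n<M. \<Sum>x\<in>E n. exp (- t * real n + orbit_sum f \<phi> n x))"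
        using E(1) by (intro sum.Sigma[symmetric]) auto
      also have "\<dots> \<le> (\<Sum>n<M. q ^ n)"
        by (rule sum_mono) (rule level)
      also have "\<dots> \<le> 1 / (1 - q)"
        using q by (auto simp: sum_gp_strict divide_right_mono)
      finally show "(\<Sum>(n, x)\<in>F. ennreal (exp (- t * real n + orbit_sum f \<phi> n x))) \<le> ennreal (1 / (1 - q))"
        by (subst (asm) ennreal_le_iff[symmetric]) (use q in \<open>auto simp: split_def\<close>)
    qed
    finally show ?thesis .
  qed
  \<comment> \<open>The bound does not depend on \<open>N\<close>, so it survives the limit.\<close>
  then have "pressure_outer X f \<phi> Z t r \<le> ennreal (1 / (1 - q))"
    by (intro LIMSEQ_le_const2[OF pressure_outer_tendsto]) auto
  also have "\<dots> < \<infinity>" by simp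
  finally show ?thesis .
qed

text \<open>The local limsup grows as the radius shrinks, so the bound \<open>s\<close> on its limit
  holds at every positive radius.\<close>

lemma topological_pressure_le:
  assumes "compact X" "continuous_on X f" "f \<in> X \<rightarrow> X" "continuous_on X \<phi>"
    and "prob_space \<mu>" "sets \<mu> = sets (restrict_space borel X)"
    and "Z \<subseteq> X" "0 \<le> s"
    and Z: "\<And>x. x \<in> Z \<Longrightarrow> upper_local_pressure X f \<phi> \<mu> x \<le> ereal s"
  shows "topological_pressure X f \<phi> Z \<le> ereal s"
proof (rule tendsto_upperbound[OF topological_pressure_tendsto])
  have limsup_le: "limsup (local_pressure_term X f \<phi> \<mu> x e) \<le> ereal s" if "x \<in> Z" "0 < e" for x e
  proof -
    have "x \<in> X" using that \<open>Z \<subseteq> X\<close> by auto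
    note tendsto = upper_local_pressure_tendsto[OF assms(2,3) this assms(5,6)]
    have "limsup (local_pressure_term X f \<phi> \<mu> x e) \<le> upper_local_pressure X f \<phi> \<mu> x"
      by (rule antimono_le_limit_at_right_0[OF _ tendsto \<open>0 < e\<close>])
        (intro Limsup_mono always_eventually allI
          local_pressure_term_antimono[OF assms(2,3) \<open>x \<in> X\<close> assms(5,6)])
    with Z[OF that(1)] show ?thesis by (rule order_trans[rotated])
  qed
  have "critical_pressure X f \<phi> Z r \<le> ereal s" if "0 < r" for r
    unfolding critical_pressure_def
  proof (rule Sup_least, elim insertE)
    fix v assume "v \<in> {ereal t | t. 0 \<le> t \<and> pressure_outer X f \<phi> Z t r = \<infinity>}"
    then obtain t where t: "v = ereal t" "pressure_outer X f \<phi> Z t r = \<infinity>" by auto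
    have "t \<le> s"
    proof (rule ccontr)
      assume "\<not> t \<le> s"
      \<comment> \<open>\<open>s < u\<close> turns the weak bound into the strict one required for
        the covers, and \<open>u < t\<close> makes the geometric series converge.\<close>
      then obtain u where "s < u" "u < t" using dense[of s t] by auto
      have "limsup (local_pressure_term X f \<phi> \<mu> x (r / 2)) < ereal u" if "x \<in> Z" for x
        using limsup_le[OF that, of "r / 2"] \<open>0 < r\<close> \<open>s < u\<close> by (auto elim: le_less_trans)
      from pressure_outer_less_top[OF assms(1-6) \<open>0 < r\<close> \<open>Z \<subseteq> X\<close> \<open>u < t\<close> this] t(2)
      show False by simp
    qed
    with t(1) show "v \<le> ereal s" by simp
  \<comment> \<open>The value 0 inserted into the supremum is where the sign of \<open>s\<close>
    enters.\<close>
  qed (use \<open>0 \<le> s\<close> in simp)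
  then show "\<forall>\<^sub>F r in at_right 0. critical_pressure X f \<phi> Z r \<le> ereal s"
    using eventually_at_right_less[of 0] by (rule eventually_mono[rotated])
qed simp

section \<open>Lower bound: null sets from covers of bounded cost\<close>

text \<open>The outer measure avoids showing that \<open>x \<mapsto> \<mu> (B\<^sub>n (x, \<epsilon>))\<close> is measurable.\<close>

lemma outer_measure_eq_0_of_pressure_outer:
  assumes "continuous_on X f" "f \<in> X \<rightarrow> X"
    and "prob_space \<mu>" "sets \<mu> = sets (restrict_space borel X)"
    and "A \<subseteq> Z" "0 < \<delta>" "2 * r \<le> \<epsilon>"
    and \<delta>: "\<And>x y. x \<in> X \<Longrightarrow> y \<in> X \<Longrightarrow> dist x y < r \<Longrightarrow> \<phi> y \<le> \<phi> x + \<delta>"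
    and A: "\<And>x n. x \<in> A \<Longrightarrow> m \<le> n \<Longrightarrow>
      measure \<mu> (bowen_ball X f n x \<epsilon>) \<le> exp (orbit_sum f \<phi> n x - (t + 2 * \<delta>) * real n)"
    and finite: "pressure_outer X f \<phi> Z t r < \<infinity>"
  shows "outer_measure_of \<mu> A = 0"
proof -
  interpret prob_space \<mu> by fact
  have B: "bowen_ball X f n x e \<in> sets \<mu>" if "x \<in> X" for n x e
    unfolding assms(4) using assms(1,2) that by (rule bowen_ball_measurable)
  \<comment> \<open>The infima increase to a limit strictly below \<open>c\<close>, so every
    \<open>N\<close> admits an actual cover of cost below the same \<open>c\<close>.\<close>
  obtain c where c: "0 \<le> c" "pressure_outer X f \<phi> Z t r < ennreal c"
    using finite by (metis ennreal_cases infinity_ennreal_def less_top ennreal_less_top dense)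
  have incseq: "incseq (pressure_cover_inf X f \<phi> Z t r)"
    by (rule monoI) (rule pressure_cover_inf_mono, simp_all)
  have bound: "outer_measure_of \<mu> A \<le> ennreal (exp (- \<delta> * real N) * c)" if "m \<le> N" for N
  proof -
    have "pressure_cover_inf X f \<phi> Z t r N < ennreal c"
      using incseq_le[OF incseq pressure_outer_tendsto] c(2) by (rule le_less_trans)
    then obtain J :: "nat set" and n x where
      J: "\<And>j. j \<in> J \<Longrightarrow> x j \<in> X \<and> N \<le> n j" and cover: "Z \<subseteq> (\<Union>j\<in>J. bowen_ball X f (n j) (x j) r)"
      and sum: "(\<Sum>\<^sub>\<infinity>j\<in>J. ennreal (exp (- t * real (n j) + orbit_sum f \<phi> (n j) (x j)))) < ennreal c"
      unfolding pressure_cover_inf_def Inf_less_iff by blast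
    define w where "w j = exp (- t * real (n j) + orbit_sum f \<phi> (n j) (x j))" for j
    define B where "B j = bowen_ball X f (n j) (x j) r" for j
    \<comment> \<open>Only balls meeting \<open>A\<close> are kept: a point of \<open>A\<close>
      inside serves as a new centre, where the mass bound applies.\<close>
    define J' where "J' = {j \<in> J. B j \<inter> A \<noteq> {}}"
    have B_sets: "B j \<in> sets \<mu>" if "j \<in> J" for j
      unfolding B_def using J[OF that] by (intro B) simp
    have meas: "measure \<mu> (B j) \<le> exp (- \<delta> * real N) * w j" if "j \<in> J'" for j
    proof -
      have "x j \<in> X" "N \<le> n j" using that J by (auto simp: J'_def)
      obtain y where y: "y \<in> A" "y \<in> bowen_ball X f (n j) (x j) r"
        using \<open>j \<in> J'\<close> by (auto simp: J'_def B_def)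
      have "y \<in> X" using y(2) by (simp add: bowen_ball_def)
      have "B j \<subseteq> bowen_ball X f (n j) y (r + r)"
        unfolding B_def using bowen_ball_trans[OF bowen_ball_sym[OF \<open>x j \<in> X\<close> y(2)]] by blast
      also have "\<dots> \<subseteq> bowen_ball X f (n j) y \<epsilon>"
        using assms(7) by (intro bowen_ball_mono) simp
      finally have "measure \<mu> (B j) \<le> measure \<mu> (bowen_ball X f (n j) y \<epsilon>)"
        by (rule finite_measure_mono) (rule B[OF \<open>y \<in> X\<close>])
      also have "\<dots> \<le> exp (orbit_sum f \<phi> (n j) y - (t + 2 * \<delta>) * real (n j))"
        using \<open>m \<le> N\<close> \<open>N \<le> n j\<close> by (intro A y(1)) simp
      \<comment> \<open>One \<open>\<delta>\<close> in the exponent pays for moving the orbit sum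
        from \<open>y\<close> to \<open>x j\<close>; the other yields the factor
        \<open>exp (- \<delta> * real N)\<close> because \<open>N \<le> n j\<close>.\<close>
      also have "\<dots> \<le> exp (- \<delta> * real N + (- t * real (n j) + orbit_sum f \<phi> (n j) (x j)))"
      proof -
        have "orbit_sum f \<phi> (n j) y \<le> orbit_sum f \<phi> (n j) (x j) + \<delta> * real (n j)"
          using assms(2) \<open>x j \<in> X\<close> y(2) \<delta> by (rule orbit_sum_bowen_ball_le)
        moreover have "\<delta> * real N \<le> \<delta> * real (n j)"
          using \<open>N \<le> n j\<close> \<open>0 < \<delta>\<close> by simp
        ultimately show ?thesis by (simp add: algebra_simps)
      qed
      also have "\<dots> = exp (- \<delta> * real N) * w j" by (simp only: w_def exp_add)
      finally show ?thesis .
    qed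
    have "A \<subseteq> (\<Union>j\<in>J'. B j)"
      using cover \<open>A \<subseteq> Z\<close> by (fastforce simp: J'_def B_def)
    then have "outer_measure_of \<mu> A \<le> outer_measure_of \<mu> (\<Union>j\<in>J'. B j)"
      by (rule outer_measure_of_mono)
    also have "\<dots> = emeasure \<mu> (\<Union>j\<in>J'. B j)"
      using B_sets by (intro outer_measure_of_eq sets.countable_UN') (auto simp: J'_def)
    also have "\<dots> \<le> (\<Sum>\<^sub>\<infinity>j\<in>J'. emeasure \<mu> (B j))"
      using B_sets by (intro emeasure_UN_le_infsum) (auto simp: J'_def)
    also have "\<dots> \<le> ennreal (exp (- \<delta> * real N) * c)"
    proof (rule infsum_ennreal_le)
      fix F assume F: "finite F" "F \<subseteq> J'"
      have "(\<Sum>j\<in>F. ennreal (w j)) \<le> (\<Sum>\<^sub>\<infinity>j\<in>J. ennreal (w j))"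
        using F by (intro sum_le_infsum_ennreal) (auto simp: J'_def)
      also have "\<dots> \<le> ennreal c" using sum by (simp add: w_def)
      finally have "ennreal (sum w F) \<le> ennreal c"
        by (subst (asm) sum_ennreal) (auto simp: w_def)
      then have w: "sum w F \<le> c" using c(1) by simp
      have "(\<Sum>j\<in>F. measure \<mu> (B j)) \<le> (\<Sum>j\<in>F. exp (- \<delta> * real N) * w j)"
        using F meas by (intro sum_mono) auto
      also have "\<dots> \<le> exp (- \<delta> * real N) * c"
        using w by (simp add: sum_distrib_left[symmetric])
      finally show "(\<Sum>j\<in>F. emeasure \<mu> (B j)) \<le> ennreal (exp (- \<delta> * real N) * c)"
        by (simp add: emeasure_eq_measure ennreal_leI)
    qed
    finally show ?thesis .
  qed
  have "(\<lambda>N. exp (- \<delta> * real N) * c) \<longlonglongrightarrow> 0"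
    using \<open>0 < \<delta>\<close> by real_asymp
  then have "(\<lambda>N. ennreal (exp (- \<delta> * real N) * c)) \<longlonglongrightarrow> ennreal 0"
    by (rule tendsto_ennrealI)
  then have "outer_measure_of \<mu> A \<le> ennreal 0"
    by (rule LIMSEQ_le_const) (use bound in auto)
  then show ?thesis by simp
qed

lemma topological_pressure_ge:
  assumes "compact X" "continuous_on X f" "f \<in> X \<rightarrow> X" "continuous_on X \<phi>"
    and "prob_space \<mu>" "sets \<mu> = sets (restrict_space borel X)"
    and "Z \<in> sets \<mu>" "0 < measure \<mu> Z"
    and Z: "\<And>x. x \<in> Z \<Longrightarrow> ereal s \<le> lower_local_pressure X f \<phi> \<mu> x"
  shows "ereal s \<le> topological_pressure X f \<phi> Z"
proof (rule ccontr)
  interpret prob_space \<mu> by fact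
  have space: "space \<mu> = X"
    using sets_eq_imp_space_eq[OF assms(6)] by (simp add: space_restrict_space)
  have "Z \<subseteq> X" using sets.sets_into_space[OF assms(7)] by (simp add: space)
  assume "\<not> ereal s \<le> topological_pressure X f \<phi> Z"
  then obtain t where t: "topological_pressure X f \<phi> Z < ereal t" "t < s"
    using ereal_dense2[of "topological_pressure X f \<phi> Z" "ereal s"] by (auto simp: not_le)
  have critical: "critical_pressure X f \<phi> Z r < ereal t" if "0 < r" for r
    using antimono_le_limit_at_right_0[OF critical_pressure_antimono topological_pressure_tendsto that] t(1)
    by (rule le_less_trans)
  \<comment> \<open>Only nonnegative parameters are counted in \<open>critical_pressure\<close>; the
    inserted 0 forces \<open>t\<close> into that range.\<close>
  have "0 \<le> t"
  proof -
    have "0 \<le> critical_pressure X f \<phi> Z 1"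
      unfolding critical_pressure_def by (rule Sup_upper) simp
    also have "\<dots> < ereal t" by (rule critical) simp
    finally show ?thesis by simp
  qed
  have finite: "pressure_outer X f \<phi> Z t r < \<infinity>" if "0 < r" for r
  proof (rule ccontr)
    assume "\<not> ?thesis"
    then have "pressure_outer X f \<phi> Z t r = \<infinity>" by (simp add: not_less top_unique)
    with \<open>0 \<le> t\<close> have "ereal t \<le> critical_pressure X f \<phi> Z r"
      unfolding critical_pressure_def by (intro Sup_upper) auto
    with critical[OF that] show False by simp
  qed
  \<comment> \<open>Any positive value below \<open>(s - t) / 2\<close> would serve: the null set
    argument consumes \<open>2 * \<delta>\<close>, and \<open>t + 2 * \<delta>\<close> must stay
    below \<open>s\<close>.\<close>
  define \<delta> where "\<delta> = (s - t) / 3"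
  have "0 < \<delta>" "t + 2 * \<delta> < s" using t(2) by (simp_all add: \<delta>_def field_simps)
  have "uniformly_continuous_on X \<phi>"
    using assms(4,1) by (rule compact_uniformly_continuous)
  then obtain \<eta> where "0 < \<eta>" and \<eta>: "\<And>x y. x \<in> X \<Longrightarrow> y \<in> X \<Longrightarrow> dist y x < \<eta> \<Longrightarrow> dist (\<phi> y) (\<phi> x) < \<delta>"
    using \<open>0 < \<delta>\<close> unfolding uniformly_continuous_on_def by metis
  \<comment> \<open>\<open>k\<close> fixes the radius and \<open>m\<close> the length from which the
    mass bound holds, so that both are uniform on each set.\<close>
  define A where "A k m = {x \<in> Z. \<forall>n\<ge>m. measure \<mu> (bowen_ball X f n x (inverse (real (Suc k))))
      \<le> exp (orbit_sum f \<phi> n x - (t + 2 * \<delta>) * real n)}" for k m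
  have "outer_measure_of \<mu> (A k m) = 0" for k m
  proof (rule outer_measure_eq_0_of_pressure_outer[OF assms(2,3,5,6)])
    \<comment> \<open>\<open>\<eta>\<close> controls the variation of \<open>\<phi>\<close>; the
      half allows for the doubled radius after recentring.\<close>
    define r where "r = min \<eta> (inverse (real (Suc k)) / 2)"
    show "2 * r \<le> inverse (real (Suc k))" by (simp add: r_def)
    show "pressure_outer X f \<phi> Z t r < \<infinity>" by (rule finite) (simp add: r_def \<open>0 < \<eta>\<close>)
    show "\<phi> y \<le> \<phi> x + \<delta>" if "x \<in> X" "y \<in> X" "dist x y < r" for x y
      using \<eta>[OF that(1,2)] that(3) by (simp add: r_def dist_commute dist_real_def)
  qed (use \<open>0 < \<delta>\<close> in \<open>auto simp: A_def\<close>)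
  moreover have "A k m \<subseteq> space \<mu>" for k m using \<open>Z \<subseteq> X\<close> by (auto simp: A_def space)
  \<comment> \<open>Outer measure is attained by a measurable superset, which is null here.\<close>
  ultimately have "\<exists>E\<in>null_sets \<mu>. A k m \<subseteq> E" for k m
    using outer_measure_of_attain[of "A k m" \<mu>] by (fastforce simp: null_sets_def)
  then obtain E where E: "\<And>k m. E k m \<in> null_sets \<mu>" "\<And>k m. A k m \<subseteq> E k m" by metis
  have "Z \<subseteq> (\<Union>k. \<Union>m. E k m)"
  proof
    fix z assume "z \<in> Z"
    then have "z \<in> X" using \<open>Z \<subseteq> X\<close> by auto
    have "ereal (t + 2 * \<delta>) < lower_local_pressure X f \<phi> \<mu> z"
      using \<open>t + 2 * \<delta> < s\<close> Z[OF \<open>z \<in> Z\<close>] by (auto elim: less_le_trans[rotated])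
    then have "\<forall>\<^sub>F e in at_right 0. ereal (t + 2 * \<delta>) < liminf (local_pressure_term X f \<phi> \<mu> z e)"
      by (rule order_tendstoD(1)[OF lower_local_pressure_tendsto[OF assms(2,3) \<open>z \<in> X\<close> assms(5,6)]])
    \<comment> \<open>Sampling the radii along \<open>1 / (k + 1)\<close> keeps the decomposition
      countable.\<close>
    moreover have "filterlim (\<lambda>k. inverse (real (Suc k))) (at_right 0) sequentially"
      by real_asymp
    ultimately have "\<forall>\<^sub>F k in sequentially.
        ereal (t + 2 * \<delta>) < liminf (local_pressure_term X f \<phi> \<mu> z (inverse (real (Suc k))))"
      by (rule eventually_compose_filterlim)
    then obtain k where "ereal (t + 2 * \<delta>) < liminf (local_pressure_term X f \<phi> \<mu> z (inverse (real (Suc k))))"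
      unfolding eventually_sequentially by blast
    then have "\<forall>\<^sub>F n in sequentially. ereal (t + 2 * \<delta>) < local_pressure_term X f \<phi> \<mu> z (inverse (real (Suc k))) n"
      by (rule less_LiminfD)
    then have "\<forall>\<^sub>F n in sequentially. measure \<mu> (bowen_ball X f n z (inverse (real (Suc k))))
        \<le> exp (orbit_sum f \<phi> n z - (t + 2 * \<delta>) * real n)"
      using eventually_gt_at_top[of 0]
    proof eventually_elim
      case (elim n)
      from less_imp_le[OF elim(1)] show ?case
        unfolding local_pressure_term_def neg_log_quotient_ge_iff[OF elim(2) measure_nonneg] .
    qed
    then obtain m where "z \<in> A k m"
      using \<open>z \<in> Z\<close> unfolding eventually_sequentially A_def by blast
    then show "z \<in> (\<Union>k. \<Union>m. E k m)" using E(2) by blast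
  qed
  moreover have "(\<Union>k. \<Union>m. E k m) \<in> null_sets \<mu>"
    using E(1) by (intro null_sets_UN)
  ultimately have "Z \<in> null_sets \<mu>"
    using assms(7) by (rule null_sets_subset[rotated, rotated])
  with assms(8) show False by (simp add: measure_eq_0_null_sets)
qed

theorem theorem3p3:
  fixes X Z :: "'a::metric_space set" and f :: "'a \<Rightarrow> 'a" and \<phi> :: "'a \<Rightarrow> real"
    and \<mu> :: "'a measure" and s :: real
  assumes "compact X"
    and "f \<in> X \<rightarrow> X" and "continuous_on X f"
    and "Z \<in> sets (restrict_space borel X)"
    and "prob_space \<mu>" and "sets \<mu> = sets (restrict_space borel X)"
    and "0 \<le> s"
    and "continuous_on X \<phi>"
  shows "((\<forall>x\<in>Z. upper_local_pressure X f \<phi> \<mu> x \<le> ereal s) \<longrightarrow>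
            topological_pressure X f \<phi> Z \<le> ereal s) \<and>
         (measure \<mu> Z > 0 \<and> (\<forall>x\<in>Z. ereal s \<le> lower_local_pressure X f \<phi> \<mu> x) \<longrightarrow>
            ereal s \<le> topological_pressure X f \<phi> Z)"
proof (intro conjI impI; (elim conjE)?)
  have "Z \<subseteq> X"
    using sets.sets_into_space[OF assms(4)] by (simp add: space_restrict_space)
  then show "topological_pressure X f \<phi> Z \<le> ereal s"
    if "\<forall>x\<in>Z. upper_local_pressure X f \<phi> \<mu> x \<le> ereal s"
    using that topological_pressure_le[OF assms(1,3,2,8,5,6) _ assms(7)] by blast
  show "ereal s \<le> topological_pressure X f \<phi> Z"
    if "measure \<mu> Z > 0" "\<forall>x\<in>Z. ereal s \<le> lower_local_pressure X f \<phi> \<mu> x"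
    using that assms(4,6) topological_pressure_ge[OF assms(1,3,2,8,5,6)] by blast
qed

end
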